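(* The functions $c_1(S)$ and $c_2(S)$ are submodular as functions of $S\subseteq V$.
   Context: **System.** $V=\{1,\dots,n\}$ indexes the states of $F\dot{\mathbf{x}}(t)=A\mathbf{x}(t)$, where $F=Q_F+T_F$, $A=Q_A+T_A$ are $n\times n$; $Q_F,Q_A$ are known fixed real matrices and $T_F,T_A$ are structure matrices: their nonzero entries are independent free parameters that can take any real value. The system is assumed solvable: for every initial state there is a unique trajectory. For an input set $S\subseteq V$, the controlled system is represented as $F\dot{\mathbf{x}}=A\mathbf{x}+B\mathbf{u}$ with $B=T_B(S)$, the $n\times n$ diagonal matrix with a free parameter in the $i$-th diagonal entry for $i\in S$ and zeros elsewhere. **First graph controllability index.** $c_1(S)=\max\{|V'|: V'\subseteq V,\ \mathrm{rank}(A(V')\,|\,B(V'))=|V'|\}$, where $A(V'),B(V')$ are the submatrices of $A,B$ consisting of the rows and columns indexed in $V'$, and rank is understood for generic values of the free parameters. **Auxiliary graph.** Let $\Omega=\begin{pmatrix}Q_A-Q_F\\ I\end{pmatrix}$, with rows indexed $w_1,\dots,w_n,x_1,\dots,x_n$. Say $(i,j)\in T$ if the $(i,j)$ entry of $T_A$ or $T_F$ is nonzero. Let $H$ be the bipartite graph with sides $\{w_i^T\}$ and $\{w_i^Q\}\cup\{x_i^Q\}$ and edges $(w_i^T,w_i^Q)$ for all $i$, and $(w_i^T,x_j^Q)$ for $(i,j)\in T$. By solvability there is a matching $m$ of $H$ matching all $w_i^T$ such that the rows in $J=\{w_i:m(w_i^T)=w_i^Q\}\cup\{x_j: m(w_i^T)=x_j^Q\text{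 for some }i\}$ are linearly independent in $\Omega$; fix such an $m$. Let $\Omega_J$ be the submatrix of rows $J$ and $\tilde\Omega=\Omega\Omega_J^{-1}$, with columns indexed by $J$. $G'$ is the directed graph with vertices $w_i^T,w_i^Q,x_i^T,x_i^Q$ ($i=1,\dots,n$) and edges: $w_i^T\to x_j^Q$ if $(i,j)\in T$, $m(w_i^T)\ne x_j^Q$; $x_j^Q\to w_i^T$ if $(i,j)\in T$, $m(w_i^T)=x_j^Q$; $w_i^T\to w_i^Q$ if $m(w_i^T)\neq w_i^Q$; $w_i^Q\to w_i^T$ if $m(w_i^T)=w_i^Q$; $a^Q\to b^Q$ for $a\notin J$, $b\in J$, $\tilde\Omega_{ab}\ne0$. For input set $S$, $\hat G$ is $G'$ with additional vertices $u_i^T,u_i^Q$ and edges $w_i^T\to u_i^T$, $u_i^T\to u_i^Q$ for $i\in S$. **Second graph controllability index.** $c_2(S)=|\{i\in V: i\text{ is reachable to }\mathbf{u}\text{ in }\hat G\}|$, i.e. (identifying $i$ with the vertex $w_i^T$) the number of $i\in V$ from which there is a directed path in $\hat G$ to some $u_j^Q$, $j\in S$. *)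

theory Defs
  imports "HOL-Analysis.Analysis"
begin

text \<open>
  The state set \<open>V\<close> is the universe of the finite type \<open>'n\<close>.  A structure matrix is given by the
  set of positions of its nonzero entries; the values of its free parameters are read off from an
  arbitrary real matrix at these positions.  All other entries of that matrix are dummy
  coordinates.
\<close>

definition structure_matrix :: "('n \<times> 'n) set \<Rightarrow> real^'n^'n \<Rightarrow> real^'n^'n" where
  "structure_matrix P \<theta> = (\<chi> i j. if (i, j) \<in> P then \<theta> $ i $ j else 0)"

definition input_matrix :: "'n set \<Rightarrow> real^'n \<Rightarrow> real^'n^'n" where
  "input_matrix S \<beta> = (\<chi> i j. if i = j \<and> i \<in> S then \<beta> $ i else 0)"

text \<open>
  A property holds generically if it holds off the zero set of some nonzero polynomial in the
  parameters.  Dummy coordinates do not matter: for a property that does not depend on them,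
  they can be fixed in the polynomial at values for which it remains nonzero.
\<close>

definition generically :: "('p::real_normed_vector \<Rightarrow> bool) \<Rightarrow> bool" where
  "generically P \<longleftrightarrow>
     (\<exists>p. real_polynomial_function p \<and> (\<exists>\<theta>. p \<theta> \<noteq> 0) \<and> (\<forall>\<theta>. p \<theta> \<noteq> 0 \<longrightarrow> P \<theta>))"

definition submodular :: "('a set \<Rightarrow> nat) \<Rightarrow> bool" where
  "submodular f \<longleftrightarrow> (\<forall>S T. f (S \<union> T) + f (S \<inter> T) \<le> f S + f T)"


subsection \<open>Solvability\<close>

definition trajectory :: "real^'n^'n \<Rightarrow> real^'n^'n \<Rightarrow> (real \<Rightarrow> real^'n) \<Rightarrow> bool" where
  "trajectory F A x \<longleftrightarrow>
     (\<forall>t\<ge>0. \<exists>v. (x has_vector_derivative v) (at t within {0..}) \<and> F *v v = A *v x t)"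

definition unique_trajectory_from :: "real^'n^'n \<Rightarrow> real^'n^'n \<Rightarrow> real^'n \<Rightarrow> bool" where
  "unique_trajectory_from F A x0 \<longleftrightarrow>
     (\<exists>x. trajectory F A x \<and> x 0 = x0 \<and>
        (\<forall>y. trajectory F A y \<and> y 0 = x0 \<longrightarrow> (\<forall>t\<ge>0. y t = x t)))"

text \<open>
  If \<open>F\<close> is singular, the algebraic constraints hidden in the system restrict the states in which
  the system can be at time \<open>0\<close>.  An initial state therefore means a consistent one.
  Quantifying over all vectors instead would leave only systems with \<open>F\<close> nonsingular; that
  stronger condition implies the present one, see \<open>solvable_if_all_initial_states\<close>.
\<close>

definition consistent_initial_state :: "real^'n^'n \<Rightarrow> real^'n^'n \<Rightarrow> real^'n \<Rightarrow> bool" where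
  "consistent_initial_state F A x0 \<longleftrightarrow> (\<exists>x. trajectory F A x \<and> x 0 = x0)"

definition solvable :: "real^'n^'n \<Rightarrow> real^'n^'n \<Rightarrow> bool" where
  "solvable F A \<longleftrightarrow>
     (\<forall>x0. consistent_initial_state F A x0 \<longrightarrow> unique_trajectory_from F A x0)"

lemma solvable_if_all_initial_states:
  "(\<And>x0. unique_trajectory_from F A x0) \<Longrightarrow> solvable F A"
  by (simp add: solvable_def)

definition structurally_solvable ::
    "real^'n^'n \<Rightarrow> ('n \<times> 'n) set \<Rightarrow> real^'n^'n \<Rightarrow> ('n \<times> 'n) set \<Rightarrow> bool" where
  "structurally_solvable QF TF QA TA \<longleftrightarrow>
     generically (\<lambda>(\<theta>F, \<theta>A). solvable (QF + structure_matrix TF \<theta>F) (QA + structure_matrix TA \<theta>A))"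


subsection \<open>First graph controllability index\<close>

text \<open>
  Submatrices are padded with zeros to full size, which does not change their rank.
\<close>

definition principal_submatrix :: "'n set \<Rightarrow> real^'n^'n \<Rightarrow> real^'n^'n" where
  "principal_submatrix V' M = (\<chi> i j. if i \<in> V' \<and> j \<in> V' then M $ i $ j else 0)"

definition augment_cols :: "real^'a^'r \<Rightarrow> real^'b^'r \<Rightarrow> real^('a + 'b)^'r" where
  "augment_cols M N = (\<chi> i k. case k of Inl j \<Rightarrow> M $ i $ j | Inr j \<Rightarrow> N $ i $ j)"

definition c1 :: "real^'n^'n \<Rightarrow> ('n \<times> 'n) set \<Rightarrow> 'n set \<Rightarrow> nat" where
  "c1 QA TA S =
     Max {card V' | V'.
       generically (\<lambda>(\<theta>A, \<beta>).
         rank (augment_cols (principal_submatrix V' (QA + structure_matrix TA \<theta>A))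
                            (principal_submatrix V' (input_matrix S \<beta>)))
         = card V')}"


subsection \<open>Auxiliary graph and second graph controllability index\<close>

text \<open>
  In the index type \<open>'n + 'n\<close>, \<open>Inl i\<close> stands for \<open>w\<^sub>i\<close> and \<open>Inr i\<close> for \<open>x\<^sub>i\<close>.
\<close>

definition Omega :: "real^'n^'n \<Rightarrow> real^'n^'n \<Rightarrow> real^'n^('n + 'n)" where
  "Omega QF QA = (\<chi> a. case a of Inl i \<Rightarrow> (QA - QF) $ i | Inr i \<Rightarrow> mat 1 $ i)"

text \<open>
  An edge \<open>(i, a)\<close> of \<open>H\<close> joins \<open>w\<^sub>i\<^sup>T\<close> to \<open>a\<^sup>Q\<close>.  A matching that covers all \<open>w\<^sub>i\<^sup>T\<close> is represented by
  the function \<open>m\<close> sending \<open>i\<close> to the \<open>a\<close> for which \<open>a\<^sup>Q\<close> is the partner of \<open>w\<^sub>i\<^sup>T\<close>.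
\<close>

definition H_edges :: "('n \<times> 'n) set \<Rightarrow> ('n \<times> ('n + 'n)) set" where
  "H_edges T = {(i, Inl i) | i. True} \<union> {(i, Inr j) | i j. (i, j) \<in> T}"

definition covering_matching :: "('n \<times> 'n) set \<Rightarrow> ('n \<Rightarrow> 'n + 'n) \<Rightarrow> bool" where
  "covering_matching T m \<longleftrightarrow> (\<forall>i. (i, m i) \<in> H_edges T) \<and> inj m"

definition matched_rows :: "('n \<Rightarrow> 'n + 'n) \<Rightarrow> ('n + 'n) set" where
  "matched_rows m = {Inl i | i. m i = Inl i} \<union> {Inr j | j. \<exists>i. m i = Inr j}"

text \<open>
  Linear independence is that of the family of rows, so distinct indices must give distinct rows.
\<close>

definition admissible_matching ::
    "real^'n^'n \<Rightarrow> ('n \<times> 'n) set \<Rightarrow> real^'n^'n \<Rightarrow> ('n \<times> 'n) set \<Rightarrow> ('n \<Rightarrow> 'n + 'n) \<Rightarrow> bool" where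
  "admissible_matching QF TF QA TA m \<longleftrightarrow>
     covering_matching (TA \<union> TF) m \<and>
     inj_on (\<lambda>a. row a (Omega QF QA)) (matched_rows m) \<and>
     independent ((\<lambda>a. row a (Omega QF QA)) ` matched_rows m)"

text \<open>
  For an admissible \<open>m\<close>, the map \<open>m\<close> is a bijection from \<open>'n\<close> onto \<open>J = matched_rows m\<close>.  It is used
  to label the rows of \<open>\<Omega>\<^sub>J\<close> and the columns of \<open>\<Omega> \<Omega>\<^sub>J\<^sup>-\<^sup>1\<close>: index \<open>k\<close> stands for the element
  \<open>m k\<close> of \<open>J\<close>.
\<close>

definition Omega_J :: "real^'n^'n \<Rightarrow> real^'n^'n \<Rightarrow> ('n \<Rightarrow> 'n + 'n) \<Rightarrow> real^'n^'n" where
  "Omega_J QF QA m = (\<chi> k. Omega QF QA $ m k)"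

definition Omega_tilde :: "real^'n^'n \<Rightarrow> real^'n^'n \<Rightarrow> ('n \<Rightarrow> 'n + 'n) \<Rightarrow> real^'n^('n + 'n)" where
  "Omega_tilde QF QA m = Omega QF QA ** matrix_inv (Omega_J QF QA m)"

text \<open>
  \<open>TNode a\<close> is \<open>a\<^sup>T\<close> and \<open>QNode a\<close> is \<open>a\<^sup>Q\<close>, for \<open>a\<close> one of the \<open>w\<^sub>i\<close> and \<open>x\<^sub>i\<close>.
  The vertices \<open>UT i\<close> and \<open>UQ i\<close> with \<open>i\<close> outside the input set are isolated.
\<close>

datatype 'n vertex = TNode "'n + 'n" | QNode "'n + 'n" | UT 'n | UQ 'n

definition G'_edges ::
    "real^'n^'n \<Rightarrow> ('n \<times> 'n) set \<Rightarrow> real^'n^'n \<Rightarrow> ('n \<times> 'n) set \<Rightarrow> ('n \<Rightarrow> 'n + 'n)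
     \<Rightarrow> ('n vertex \<times> 'n vertex) set" where
  "G'_edges QF TF QA TA m =
     {(TNode (Inl i), QNode (Inr j)) | i j. (i, j) \<in> TA \<union> TF \<and> m i \<noteq> Inr j} \<union>
     {(QNode (Inr j), TNode (Inl i)) | i j. (i, j) \<in> TA \<union> TF \<and> m i = Inr j} \<union>
     {(TNode (Inl i), QNode (Inl i)) | i. m i \<noteq> Inl i} \<union>
     {(QNode (Inl i), TNode (Inl i)) | i. m i = Inl i} \<union>
     {(QNode a, QNode (m k)) | a k. a \<notin> matched_rows m \<and> Omega_tilde QF QA m $ a $ k \<noteq> 0}"

definition Ghat_edges ::
    "real^'n^'n \<Rightarrow> ('n \<times> 'n) set \<Rightarrow> real^'n^'n \<Rightarrow> ('n \<times> 'n) set \<Rightarrow> ('n \<Rightarrow> 'n + 'n) \<Rightarrow> 'n set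
     \<Rightarrow> ('n vertex \<times> 'n vertex) set" where
  "Ghat_edges QF TF QA TA m S =
     G'_edges QF TF QA TA m \<union>
     {(TNode (Inl i), UT i) | i. i \<in> S} \<union>
     {(UT i, UQ i) | i. i \<in> S}"

definition c2 ::
    "real^'n^'n \<Rightarrow> ('n \<times> 'n) set \<Rightarrow> real^'n^'n \<Rightarrow> ('n \<times> 'n) set \<Rightarrow> ('n \<Rightarrow> 'n + 'n) \<Rightarrow> 'n set \<Rightarrow> nat" where
  "c2 QF TF QA TA m S =
     card {i. \<exists>j\<in>S. (TNode (Inl i), UQ j) \<in> (Ghat_edges QF TF QA TA m S)\<^sup>*}"

end

theory Submission
  imports Defs "HOL-Computational_Algebra.Polynomial"
begin

text \<open>
  Second index. The vertices added for the inputs are sinks apart from the edges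
  \<open>u\<^sub>j\<^sup>T \<rightarrow> u\<^sub>j\<^sup>Q\<close>, so \<open>i\<close> reaches \<open>u\<^sub>j\<^sup>Q\<close> exactly if it reaches \<open>w\<^sub>j\<^sup>T\<close> in \<open>G'\<close>
  (\<open>reaches_UQ_iff\<close>). Hence \<open>c2 S\<close> is the size of a union, over \<open>j \<in> S\<close>, of sets that do not depend
  on \<open>S\<close>, and such coverage functions are submodular.

  First index. Fix a real matrix \<open>A\<close> and a diagonal matrix \<open>D\<close>, write \<open>N = D A\<close> and let \<open>E\<^sub>S\<close> be the
  coordinate subspace of \<open>S\<close>. Put \<open>W\<^sub>0 = \<real>\<^sup>n\<close> and \<open>W\<^sub>k\<^sub>+\<^sub>1 = N W\<^sub>k + E\<^sub>S\<close>. The space \<open>W\<^sub>n\<close> satisfies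
  \<open>N W\<^sub>n + E\<^sub>S = W\<^sub>n\<close>. As a function of the subspace \<open>E\<^sub>S\<close>, it is monotone and turns sums into sums,
  so by the dimension formula \<open>S \<mapsto> dim W\<^sub>n\<close> is submodular (\<open>dim_reach_space_submodular\<close>). It
  remains to see that \<open>c1 S\<close> is the value of \<open>dim W\<^sub>n\<close> for generic \<open>A\<close> and generic \<open>D\<close>. Only the following
  two inequalities are used.

  \<^item> For all \<open>A\<close> of the given structure and all \<open>D\<close>, \<open>dim W\<^sub>n \<le> c1 S\<close> (\<open>dim_reach_space_le_c1\<close>). Since
    \<open>N W\<^sub>n + E\<^sub>S = W\<^sub>n\<close>, there is a feedback \<open>K\<close> into the inputs for which the closed-loop matrix
    \<open>M = N + B\<^sub>S K\<close> maps \<open>W\<^sub>n\<close> onto itself (\<open>feedback_surjective_on\<close>). A matrix that maps an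
    \<open>r\<close>-dimensional subspace onto itself has a nonsingular principal submatrix with index set \<open>V\<close> of size at
    least \<open>r\<close> (\<open>principal_minor_of_invariant_subspace\<close>). Its rows in \<open>V - S\<close> are multiples of rows
    of \<open>A\<close>, so the rank condition in the definition of \<open>c1\<close> holds for \<open>V\<close>.

  \<^item> If the rank condition holds for \<open>V\<close>, take for \<open>D\<close> the indicator of \<open>V\<close>; then some closed-loop
    matrix maps \<open>E\<^sub>V\<close> onto itself, so its \<open>n\<close>-th power has rank at least \<open>|V|\<close>
    (\<open>closed_loop_of_full_rank\<close>). This lower bound on the rank is generic in \<open>(D, K)\<close>, so one pair
    \<open>(D, K)\<close> serves for optimal sets \<open>V\<close> of both \<open>S \<union> T\<close> and \<open>S \<inter> T\<close>. The range of the \<open>n\<close>-th power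
    of \<open>N + B\<^sub>S K\<close> lies in \<open>W\<^sub>n\<close>, which gives \<open>c1 \<le> dim W\<^sub>n\<close> for these two sets.

  The nonsingular principal submatrix of a matrix \<open>M\<close> that maps an \<open>r\<close>-dimensional subspace onto itself is
  found in the polynomial \<open>det (X I + M)\<close>. This polynomial is not divisible by \<open>X\<^sup>n\<^sup>-\<^sup>r\<^sup>+\<^sup>1\<close>
  (\<open>not_dvd_pencil_det\<close>), and its coefficient at \<open>X\<^sup>n\<^sup>-\<^sup>k\<close> is the sum of the principal minors of size
  \<open>k\<close>; hence one of the principal minors of size at least \<open>r\<close> does not vanish.
\<close>

section \<open>Reachability in the auxiliary graph\<close>

lemma submodular_card_UNION:
  fixes R :: "'n::finite \<Rightarrow> 'n set"
  shows "submodular (\<lambda>S. card (\<Union>j\<in>S. R j))"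
  unfolding submodular_def
proof (intro allI)
  fix S T :: "'n set"
  let ?U = "\<lambda>S. \<Union>j\<in>S. R j"
  have "card (?U (S \<inter> T)) \<le> card (?U S \<inter> ?U T)"
    by (intro card_mono) auto
  moreover have "card (?U S) + card (?U T) = card (?U S \<union> ?U T) + card (?U S \<inter> ?U T)"
    by (rule card_Un_Int) auto
  ultimately show "card (?U (S \<union> T)) + card (?U (S \<inter> T)) \<le> card (?U S) + card (?U T)"
    by (simp add: UN_Un)
qed

lemma reaches_UQ_iff:
  assumes "j \<in> S"
  shows "(TNode (Inl i), UQ j) \<in> (Ghat_edges QF TF QA TA m S)\<^sup>* \<longleftrightarrow>
    (TNode (Inl i), TNode (Inl j)) \<in> (G'_edges QF TF QA TA m)\<^sup>*"
proof
  let ?G = "G'_edges QF TF QA TA m" and ?H = "Ghat_edges QF TF QA TA m S"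
  assume "(TNode (Inl i), UQ j) \<in> ?H\<^sup>*"
  moreover have "case v of UT k \<Rightarrow> (TNode (Inl i), TNode (Inl k)) \<in> ?G\<^sup>*
      | UQ k \<Rightarrow> (TNode (Inl i), TNode (Inl k)) \<in> ?G\<^sup>* | _ \<Rightarrow> (TNode (Inl i), v) \<in> ?G\<^sup>*"
    if "(TNode (Inl i), v) \<in> ?H\<^sup>*" for v
    using that
  proof (induction rule: rtrancl_induct)
    case base
    then show ?case by simp
  next
    case (step v w)
    from step.hyps(2) consider "(v, w) \<in> ?G"
      | k where "v = TNode (Inl k)" "w = UT k" | k where "v = UT k" "w = UQ k"
      unfolding Ghat_edges_def by blast
    then show ?case
    proof cases
      case 1
      then have "(\<exists>a. v = TNode a \<or> v = QNode a) \<and> (\<exists>a. w = TNode a \<or> w = QNode a)"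
        unfolding G'_edges_def by blast
      then show ?thesis
        using step.IH 1 by (auto intro: rtrancl.rtrancl_into_rtrancl)
    qed (use step.IH in auto)
  qed
  ultimately show "(TNode (Inl i), TNode (Inl j)) \<in> ?G\<^sup>*"
    by fastforce
next
  let ?G = "G'_edges QF TF QA TA m" and ?H = "Ghat_edges QF TF QA TA m S"
  assume "(TNode (Inl i), TNode (Inl j)) \<in> ?G\<^sup>*"
  moreover have "?G\<^sup>* \<subseteq> ?H\<^sup>*"
    by (rule rtrancl_mono) (auto simp: Ghat_edges_def)
  moreover have "(TNode (Inl j), UT j) \<in> ?H" "(UT j, UQ j) \<in> ?H"
    using assms by (auto simp: Ghat_edges_def)
  ultimately show "(TNode (Inl i), UQ j) \<in> ?H\<^sup>*"
    by (meson rtrancl.rtrancl_into_rtrancl subsetD)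
qed

lemma submodular_c2: "submodular (c2 QF TF QA TA m)"
proof -
  have "c2 QF TF QA TA m S =
      card (\<Union>j\<in>S. {i. (TNode (Inl i), TNode (Inl j)) \<in> (G'_edges QF TF QA TA m)\<^sup>*})" for S
    unfolding c2_def by (rule arg_cong[where f = card]) (auto simp: reaches_UQ_iff)
  then have "c2 QF TF QA TA m =
      (\<lambda>S. card (\<Union>j\<in>S. {i. (TNode (Inl i), TNode (Inl j)) \<in> (G'_edges QF TF QA TA m)\<^sup>*}))"
    by (rule ext)
  then show ?thesis
    by (metis submodular_card_UNION)
qed

section \<open>Generic properties\<close>

lemma generically_conj:
  assumes "generically P" "generically Q"
  shows "generically (\<lambda>\<theta>. P \<theta> \<and> Q \<theta>)"
proof -
  obtain p q a b where p: "real_polynomial_function p" "p a \<noteq> 0" "\<And>\<theta>. p \<theta> \<noteq> 0 \<Longrightarrow> P \<theta>"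
    and q: "real_polynomial_function q" "q b \<noteq> 0" "\<And>\<theta>. q \<theta> \<noteq> 0 \<Longrightarrow> Q \<theta>"
    using assms unfolding generically_def by auto
  \<comment> \<open>Neither polynomial vanishes identically on the line \<open>l\<close> through \<open>a\<close> and \<open>b\<close>, so each has finitely
      many zeros there.\<close>
  define l where "l s = a + s *\<^sub>R (b - a)" for s :: real
  have l: "polynomial_function l"
    unfolding l_def by (intro polynomial_function_add polynomial_function_mult) auto
  have fin: "finite {s. f (l s) = 0}" if f: "real_polynomial_function f" "f (l c) \<noteq> 0" for f c
  proof -
    have "real_polynomial_function (\<lambda>s. f (l s))"
      using real_polynomial_function_compose[OF l f(1)] by (simp add: o_def)
    then obtain k n where kn: "\<And>s. f (l s) = (\<Sum>i\<le>n. k i * s ^ i)"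
      unfolding real_polynomial_function_iff_sum by metis
    then obtain i where "i \<le> n" "k i \<noteq> 0"
      using f(2) by (metis (no_types, lifting) atMost_iff mult_zero_left sum.neutral)
    then show ?thesis
      using polyfun_finite_roots[of k n] by (auto simp: kn)
  qed
  have "finite {s. p (l s) = 0}"
    by (rule fin[of p 0]) (use p in \<open>simp_all add: l_def\<close>)
  moreover have "finite {s. q (l s) = 0}"
    by (rule fin[of q 1]) (use q in \<open>simp_all add: l_def\<close>)
  ultimately have "finite ({s. p (l s) = 0} \<union> {s. q (l s) = 0})"
    by blast
  then obtain s where "s \<notin> {s. p (l s) = 0} \<union> {s. q (l s) = 0}"
    by (metis ex_new_if_finite infinite_UNIV_char_0)
  then have "\<exists>\<theta>. p \<theta> * q \<theta> \<noteq> 0"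
    by auto
  moreover have "real_polynomial_function (\<lambda>\<theta>. p \<theta> * q \<theta>)"
    using p q by auto
  moreover have "P \<theta> \<and> Q \<theta>" if "p \<theta> * q \<theta> \<noteq> 0" for \<theta>
    using that p(3) q(3) by simp
  ultimately show ?thesis
    unfolding generically_def by (intro exI[of _ "\<lambda>\<theta>. p \<theta> * q \<theta>"]) blast
qed

lemma generically_ex: "generically P \<Longrightarrow> \<exists>\<theta>. P \<theta>"
  unfolding generically_def by blast

lemma generically_mono: "generically P \<Longrightarrow> (\<And>\<theta>. P \<theta> \<Longrightarrow> Q \<theta>) \<Longrightarrow> generically Q"
  unfolding generically_def by blast

lemma real_polynomial_function_det:
  fixes X :: "'p::real_normed_vector \<Rightarrow> real^'n^'n"
  assumes "\<And>i j. real_polynomial_function (\<lambda>p. X p $ i $ j)"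
  shows "real_polynomial_function (\<lambda>p. det (X p))"
  unfolding det_def
  by (intro real_polynomial_function_sum real_polynomial_function_prod
      real_polynomial_function.intros(2,4) assms finite_permutations finite)

lemma real_polynomial_function_matrix_mult:
  fixes X :: "'p::real_normed_vector \<Rightarrow> real^'n^'m" and Y :: "'p \<Rightarrow> real^'k^'n"
  assumes "\<And>i j. real_polynomial_function (\<lambda>p. X p $ i $ j)"
    and "\<And>i j. real_polynomial_function (\<lambda>p. Y p $ i $ j)"
  shows "real_polynomial_function (\<lambda>p. (X p ** Y p) $ i $ j)"
  unfolding matrix_matrix_mult_def vec_lambda_beta
  by (intro real_polynomial_function_sum real_polynomial_function.intros(4) assms finite)

lemma real_polynomial_function_if:
  assumes "real_polynomial_function f" "real_polynomial_function g"
  shows "real_polynomial_function (\<lambda>x. if b then f x else g x)"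
  using assms by (cases b) simp_all

text \<open>
  Lower semicontinuity of the rank: a lower bound that a matrix with polynomial entries attains
  at one point holds generically.
\<close>

lemma generically_rank_ge:
  fixes X :: "'p::real_normed_vector \<Rightarrow> real^'n^'m"
  assumes poly: "\<And>i j. real_polynomial_function (\<lambda>p. X p $ i $ j)"
    and p0: "k \<le> rank (X p0)"
  shows "generically (\<lambda>p. k \<le> rank (X p))"
proof -
  let ?U = "range ((*v) (X p0))"
  obtain B where B: "B \<subseteq> ?U" "independent B" "?U \<subseteq> span B" "card B = dim ?U"
    using basis_exists by metis
  obtain C where C: "B \<subseteq> C" "independent C" "UNIV \<subseteq> span C"
    using maximal_independent_subset_extend[of B UNIV] B by auto
  obtain h :: "real^'m \<Rightarrow> real^'m" where h: "linear h" "\<And>x. x \<in> C \<Longrightarrow> h x = (if x \<in> B then 0 else x)"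
      "range h = span ((\<lambda>x. if x \<in> B then 0 else x) ` C)"
    using linear_independent_extend_subspace[OF C(2), of "\<lambda>x. if x \<in> B then 0 else x"] by auto
  define s where "s x = (SOME y. X p0 *v y = x)" for x
  have s: "X p0 *v s x = x" if "x \<in> B" for x
    using that B(1) unfolding s_def by (metis (mono_tags, lifting) imageE someI subsetD)
  obtain f :: "real^'m \<Rightarrow> real^'n" where f: "linear f" "\<And>x. x \<in> C \<Longrightarrow> f x = (if x \<in> B then s x else 0)"
    using linear_independent_extend[OF C(2), of "\<lambda>x. if x \<in> B then s x else 0"] by auto
  define Y where "Y = matrix f"
  define Z where "Z = matrix h"
  have Y: "Y *v x = f x" and Z: "Z *v x = h x" for x
    unfolding Y_def Z_def using f(1) h(1) by (simp_all add: matrix_works)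
  have fin: "finite C"
    using C(2) by (simp add: independent_imp_finite)
  have cardC: "card C = CARD('m)"
    using C by (metis basis_card_eq_dim dim_UNIV dim_vec_eq top_greatest vec_dim_card)
  have "dim (range h) \<le> card (C - B)"
  proof -
    have "span ((\<lambda>x. if x \<in> B then 0 else x) ` C) \<subseteq> span (C - B)"
      by (intro span_minimal subspace_span) (auto intro: span_zero span_base)
    then show ?thesis
      unfolding h(3) using fin by (meson dim_le_card finite_Diff)
  qed
  then have rankZ: "rank Z + card B \<le> CARD('m)"
    using cardC C(1) fin card_mono[OF fin C(1)] unfolding rank_dim_range Z
    by (simp add: card_Diff_subset finite_subset)
  \<comment> \<open>Here \<open>Y\<close> inverts \<open>X p0\<close> on its range, and \<open>Z\<close> has the complementary rank. The polynomial
      \<open>det (X p ** Y + Z)\<close> does not vanish at \<open>p0\<close>, and where it does not vanish, \<open>X p\<close> has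
      rank at least \<open>CARD('m) - rank Z\<close>.\<close>
  have one: "X p0 ** Y + Z = mat 1"
  proof (rule matrix_eq[THEN iffD2, rule_format])
    fix x
    have lin: "linear (\<lambda>x. X p0 *v f x + h x)"
      using linear_compose[OF f(1) matrix_vector_mul_linear, of "X p0"] h(1)
      by (intro linear_compose_add) (simp_all add: o_def)
    have "X p0 *v f x + h x = x"
    proof (rule linear_eq_on_span[OF lin linear_ident, of C])
      fix b assume "b \<in> C"
      then show "X p0 *v f b + h b = b"
        using f(2) h(2) s by simp
    qed (use C in auto)
    then show "(X p0 ** Y + Z) *v x = mat 1 *v x"
      by (simp add: matrix_vector_mult_add_rdistrib Y Z flip: matrix_vector_mul_assoc)
  qed
  let ?d = "\<lambda>p. det (X p ** Y + Z)"
  have "real_polynomial_function ?d"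
    unfolding vector_add_component
    by (intro real_polynomial_function_det real_polynomial_function_matrix_mult poly
        real_polynomial_function.intros(2,3) | subst vector_add_component)+
  moreover have "?d p0 \<noteq> 0"
    by (simp add: one)
  moreover have "k \<le> rank (X p)" if "?d p \<noteq> 0" for p
  proof -
    have "invertible (X p ** Y + Z)"
      using that by (simp add: invertible_det_nz)
    then have surj: "surj ((*v) (X p ** Y + Z))"
      by (simp add: invertible_right_inverse matrix_right_invertible_surjective)
    have "UNIV \<subseteq> {x + y |x y. x \<in> range ((*v) (X p)) \<and> y \<in> range ((*v) Z)}"
    proof
      fix z :: "real^'m"
      obtain x where "z = (X p ** Y + Z) *v x"
        using surj by (rule surjE)
      then have "z = X p *v (Y *v x) + Z *v x"
        by (simp add: matrix_vector_mult_add_rdistrib matrix_vector_mul_assoc)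
      then show "z \<in> {x + y |x y. x \<in> range ((*v) (X p)) \<and> y \<in> range ((*v) Z)}"
        by blast
    qed
    then have "CARD('m) \<le> dim {x + y |x y. x \<in> range ((*v) (X p)) \<and> y \<in> range ((*v) Z)}"
      using dim_subset[of "UNIV :: (real^'m) set"] by simp
    also have "\<dots> \<le> rank (X p) + rank Z"
      unfolding rank_dim_range
      using dim_sums_Int[of "range ((*v) (X p))" "range ((*v) Z)"]
      by (simp add: linear_subspace_image)
    finally show ?thesis
      using rankZ B(4) p0 by (simp add: rank_dim_range)
  qed
  ultimately show ?thesis
    unfolding generically_def by blast
qed

section \<open>Feedback and reachable spaces\<close>

text \<open>
  The equation says that \<open>N\<close> reaches \<open>W\<close> from \<open>W\<close> up to \<open>E\<close>. The feedback \<open>K\<close> sends the kernel of \<open>N\<close>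
  on \<open>W\<close> injectively to a complement of \<open>N ` W\<close> in \<open>W\<close> that is spanned by elements of \<open>E\<close>. This makes
  \<open>N + K\<close> injective on \<open>W\<close>, hence surjective.
\<close>

lemma feedback_surjective_on:
  fixes N :: "'a::euclidean_space \<Rightarrow> 'a"
  assumes N: "linear N" and W: "subspace W" and E: "subspace E"
    and eq: "W = {N x + e | x e. x \<in> W \<and> e \<in> E}"
  obtains K where "linear K" "range K \<subseteq> E" "(\<lambda>x. N x + K x) ` W = W"
proof -
  have NW: "N ` W \<subseteq> W"
    using eq subspace_0[OF E] by force
  have EW: "E \<subseteq> W"
    using eq subspace_0[OF W] linear_0[OF N] by force
  obtain B where B: "B \<subseteq> N ` W" "independent B" "N ` W \<subseteq> span B" "card B = dim (N ` W)"
    using basis_exists by metis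
  obtain BC where BC: "B \<subseteq> BC" "BC \<subseteq> B \<union> E" "independent BC" "B \<union> E \<subseteq> span BC"
    using maximal_independent_subset_extend[of B "B \<union> E"] B by auto
  define C where "C = BC - B"
  have C: "C \<subseteq> E" "finite C" "finite BC"
    using BC C_def independent_imp_finite by auto
  have "W \<subseteq> span BC"
  proof
    fix w assume "w \<in> W"
    then have "w \<in> {N x + e | x e. x \<in> W \<and> e \<in> E}"
      by (subst (asm) eq)
    then obtain x e where "w = N x + e" "x \<in> W" "e \<in> E"
      by blast
    moreover have "N x \<in> span BC"
      using \<open>x \<in> W\<close> B(3) span_mono[OF BC(1)] by blast
    ultimately show "w \<in> span BC"
      using BC(4) by (auto intro: span_add)
  qed
  moreover have "BC \<subseteq> W"
    using BC B NW EW by blast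
  ultimately have cardBC: "card BC = dim W"
    using BC(3) by (metis basis_card_eq_dim)
  let ?Ker = "{x \<in> W. N x = 0}"
  obtain Z where Z: "Z \<subseteq> ?Ker" "independent Z" "?Ker \<subseteq> span Z" "card Z = dim ?Ker"
    by (rule basis_exists)
  have "Z \<subseteq> W" and NZ: "\<And>z. z \<in> Z \<Longrightarrow> N z = 0"
    using Z(1) by auto
  obtain D where D: "Z \<subseteq> D" "D \<subseteq> W" "independent D" "W \<subseteq> span D"
    using maximal_independent_subset_extend[OF \<open>Z \<subseteq> W\<close> Z(2)] .
  have finD: "finite D" and finZ: "finite Z"
    using independent_imp_finite[OF D(3)] independent_imp_finite[OF Z(2)] .
  have cardD: "card D = dim W"
    using basis_card_eq_dim[OF D(2,4,3)] .
  have "N ` W \<subseteq> span (N ` (D - Z))"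
  proof -
    have "N ` W \<subseteq> span (N ` D)"
      using D(4) N by (metis image_mono linear_span_image)
    also have "\<dots> \<subseteq> span (N ` (D - Z))"
    proof (intro span_minimal subspace_span subsetI)
      fix y assume "y \<in> N ` D"
      then obtain d where "d \<in> D" "y = N d" by auto
      then show "y \<in> span (N ` (D - Z))"
        using NZ[of d]
        by (cases "d \<in> Z") (auto intro: span_zero span_base)
    qed
    finally show ?thesis .
  qed
  then have "dim (N ` W) \<le> card (N ` (D - Z))"
    using finD by (intro dim_le_card) auto
  also have "\<dots> \<le> card D - card Z"
    using finD finZ D(1) by (metis card_Diff_subset card_image_le finite_Diff)
  finally have "card B + card Z \<le> dim W"
    using B(4) cardD card_mono[OF finD D(1)] by simp
  then have "card Z \<le> card C"
    using cardBC BC(1) C card_Diff_subset[of B BC] finite_subset[OF BC(1)] by (simp add: C_def)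
  then obtain g where g: "inj_on g Z" "g ` Z \<subseteq> C"
    using finZ C(2) by (meson card_le_inj)
  obtain K where K: "linear K" "\<And>z. z \<in> Z \<Longrightarrow> K z = g z" "range K = span (g ` Z)"
    using linear_independent_extend_subspace[OF Z(2), of g] by auto
  have KZ: "K ` Z = g ` Z"
    using K(2) by (intro image_cong) auto
  have rangeK: "range K \<subseteq> span C"
    using K(3) g(2) span_mono by blast
  then have rangeE: "range K \<subseteq> E"
    using C(1) E span_minimal by blast
  have "independent (K ` Z)"
    using BC(3) g(2) KZ C_def by (metis Diff_subset independent_mono)
  moreover have "inj_on K Z"
    using g(1) K(2) by (simp add: inj_on_def)
  ultimately have injK: "inj_on K (span Z)"
    using K(1) by (metis linear_inj_on_span_independent_image)
  have disj: "span B \<inter> span C \<subseteq> {0}"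
  proof -
    have "{x + y | x y. x \<in> span B \<and> y \<in> span C} = span (B \<union> C)"
      by (auto simp: span_Un)
    moreover have "B \<union> C = BC"
      using BC(1) C_def by auto
    ultimately have "dim {x + y | x y. x \<in> span B \<and> y \<in> span C} = card BC"
      using BC(3) by (simp add: dim_eq_card_independent)
    moreover have "card BC = card B + card C"
      using BC(1) C(3) C_def by (simp add: card_Diff_subset card_mono finite_subset)
    moreover have "independent C"
      using BC(3) C_def by (metis Diff_subset independent_mono)
    ultimately have "dim (span B \<inter> span C) = 0"
      using dim_sums_Int[of "span B" "span C"] B(2) by (simp add: dim_eq_card_independent)
    then show ?thesis
      by (simp add: dim_eq_0)
  qed
  let ?M = "\<lambda>x. N x + K x"
  have linM: "linear ?M"
    using N K(1) by (rule linear_compose_add)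
  have "inj_on ?M W"
  proof (rule linear_inj_on_iff_eq_0[OF linM W, THEN iffD2], intro ballI impI)
    fix x assume x: "x \<in> W" "N x + K x = 0"
    then have "N x = K (- x)"
      using K(1) by (simp add: linear_neg eq_neg_iff_add_eq_0)
    moreover have "N x \<in> span B"
      using x B(3) by auto
    ultimately have "N x = 0"
      using rangeK disj by blast
    then have "x \<in> span Z" "K x = K 0"
      using x Z(3) K(1) by (auto simp: linear_0)
    then show "x = 0"
      using injK by (auto simp: inj_on_def span_zero)
  qed
  then have "dim (?M ` W) = dim W"
    using linM W by (metis dim_image_eq subspace_span span_eq_iff)
  moreover have "?M ` W \<subseteq> W"
    using NW rangeE EW W by (auto intro!: subspace_add)
  ultimately have "?M ` W = W"
    using W linM by (intro subspace_dim_equal linear_subspace_image) auto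
  then show ?thesis
    using that K(1) rangeE by blast
qed

text \<open>
  The decreasing sequence \<open>W\<^sub>0 = UNIV\<close>, \<open>W\<^sub>k\<^sub>+\<^sub>1 = N W\<^sub>k + E\<close>. For linear \<open>N\<close> and a subspace \<open>E\<close>, \<open>W\<^sub>k\<close> is
  the sum of the range of \<open>N ^^ k\<close> and of the subspaces \<open>(N ^^ i) ` E\<close> for \<open>i < k\<close>: the states that
  the discrete-time system \<open>x \<mapsto> N x + e\<close> with inputs \<open>e \<in> E\<close> can reach at time \<open>k\<close>.
\<close>

fun reach_space :: "(('a::real_vector) \<Rightarrow> 'a) \<Rightarrow> 'a set \<Rightarrow> nat \<Rightarrow> 'a set" where
  "reach_space N E 0 = UNIV"
| "reach_space N E (Suc k) = {N x + e | x e. x \<in> reach_space N E k \<and> e \<in> E}"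

lemma subspace_linear_image_sum:
  assumes "linear N" "subspace W" "subspace E"
  shows "subspace {N x + e | x e. x \<in> W \<and> e \<in> E}"
proof -
  have "{N x + e | x e. x \<in> W \<and> e \<in> E} = {a + b | a b. a \<in> N ` W \<and> b \<in> E}"
    by blast
  then show ?thesis
    using subspace_sums[OF linear_subspace_image[OF assms(1,2)] assms(3)] by simp
qed

lemma subspace_reach_space:
  assumes "linear N" "subspace E"
  shows "subspace (reach_space N E k)"
  using assms by (induction k) (simp_all add: subspace_linear_image_sum)

lemma reach_space_decreasing: "reach_space N E (Suc k) \<subseteq> reach_space N E k"
proof (induction k)
  case (Suc k)
  then show ?case
    unfolding reach_space.simps(2)[of N E "Suc k"] reach_space.simps(2)[of N E k] by blast
qed simp

lemma reach_space_mono: "E \<subseteq> E' \<Longrightarrow> reach_space N E k \<subseteq> reach_space N E' k"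
proof (induction k)
  case (Suc k)
  then show ?case
    unfolding reach_space.simps(2) by blast
qed simp

lemma reach_space_sum:
  assumes "linear N"
  shows "reach_space N {a + b | a b. a \<in> E \<and> b \<in> E'} k =
    {x + y | x y. x \<in> reach_space N E k \<and> y \<in> reach_space N E' k}"
proof (induction k)
  case 0
  have "\<exists>x y. a = x + y" for a :: 'a by (metis add_0)
  then show ?case by auto
next
  case (Suc k)
  show ?case (is "?L = ?R")
  proof
    show "?L \<subseteq> ?R"
    proof
      fix z assume "z \<in> ?L"
      then obtain x y a b where "z = N (x + y) + (a + b)" "x \<in> reach_space N E k"
        "y \<in> reach_space N E' k" "a \<in> E" "b \<in> E'"
        using Suc by auto
      moreover from this have "z = (N x + a) + (N y + b)"
        using assms by (simp add: linear_add)
      ultimately show "z \<in> ?R" by auto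
    qed
    show "?R \<subseteq> ?L"
    proof
      fix z assume "z \<in> ?R"
      then obtain x y a b where "z = (N x + a) + (N y + b)" "x \<in> reach_space N E k"
        "y \<in> reach_space N E' k" "a \<in> E" "b \<in> E'"
        by auto
      moreover from this have "z = N (x + y) + (a + b)"
        using assms by (simp add: linear_add)
      ultimately show "z \<in> ?L" unfolding reach_space.simps(2) Suc by blast
    qed
  qed
qed

lemma reach_space_stable:
  fixes N :: "'a::euclidean_space \<Rightarrow> 'a"
  assumes "linear N" "subspace E"
  shows "reach_space N E (Suc DIM('a)) = reach_space N E DIM('a)"
proof -
  let ?W = "reach_space N E"
  \<comment> \<open>The dimension drops at each step until two consecutive spaces agree, and then all later ones do.\<close>
  have "?W (Suc k) = ?W k \<or> dim (?W k) + k \<le> DIM('a)" for k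
  proof (induction k)
    case (Suc k)
    show ?case
    proof (cases "?W (Suc k) = ?W k")
      case True
      then have "?W (Suc (Suc k)) = ?W (Suc k)"
        by (simp only: reach_space.simps(2))
      then show ?thesis ..
    next
      case False
      then have "dim (?W (Suc k)) < dim (?W k)"
        by (metis assms dim_subset le_neq_implies_less less_le_not_le linorder_not_less
            reach_space_decreasing subspace_dim_equal subspace_reach_space)
      then show ?thesis
        using Suc False by auto
    qed
  qed simp
  then consider "?W (Suc DIM('a)) = ?W DIM('a)" | "dim (?W DIM('a)) = 0"
    by (metis add_le_same_cancel2 le_zero_eq)
  then show ?thesis
  proof cases
    case 2
    then have "?W DIM('a) \<subseteq> {0}"
      by (simp only: dim_eq_0)
    then show ?thesis
      using reach_space_decreasing[of N E "DIM('a)"] subspace_0[OF subspace_reach_space[OF assms]] by blast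
  qed
qed

lemma dim_reach_space_submodular:
  fixes N :: "'a::euclidean_space \<Rightarrow> 'a"
  assumes N: "linear N" and E: "subspace E" "subspace E'" "D \<subseteq> E" "D \<subseteq> E'"
  shows "dim (reach_space N {a + b | a b. a \<in> E \<and> b \<in> E'} k) + dim (reach_space N D k)
    \<le> dim (reach_space N E k) + dim (reach_space N E' k)"
proof -
  have "reach_space N D k \<subseteq> reach_space N E k \<inter> reach_space N E' k"
    using reach_space_mono[OF E(3), of N k] reach_space_mono[OF E(4), of N k] by blast
  then have "dim (reach_space N D k) \<le> dim (reach_space N E k \<inter> reach_space N E' k)"
    by (rule dim_subset)
  then show ?thesis
    using dim_sums_Int[OF subspace_reach_space[OF N E(1)] subspace_reach_space[OF N E(2)], of k k]
    by (simp add: reach_space_sum[OF N])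
qed

text \<open>
  A feedback with values in \<open>E\<close> changes \<open>N x\<close> only by elements of \<open>E\<close>.
\<close>

lemma funpow_in_reach_space:
  assumes "range K \<subseteq> E"
  shows "((\<lambda>x. N x + K x) ^^ k) x \<in> reach_space N E k"
proof (induction k)
  case (Suc k)
  then show ?case
    using assms by (auto intro!: exI)
qed simp

section \<open>Coordinate subspaces\<close>

text \<open>
  The vectors supported in \<open>S\<close>, which is the range of the input matrix for \<open>S\<close> if its parameters
  are nonzero.
\<close>

definition coord_subspace :: "'n set \<Rightarrow> (real^'n) set" where
  "coord_subspace S = {x. \<forall>i. i \<notin> S \<longrightarrow> x $ i = 0}"

lemma subspace_coord_subspace: "subspace (coord_subspace S)"
  by (auto simp: coord_subspace_def subspace_def)

lemma dim_coord_subspace: "dim (coord_subspace S) = card S"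
  using dim_substandard_cart[of S, where 'a = real] unfolding dim_vec_eq coord_subspace_def .

lemma coord_subspace_Un:
  fixes S T :: "'n::finite set"
  shows "coord_subspace (S \<union> T) = {x + y | x y. x \<in> coord_subspace S \<and> y \<in> coord_subspace T}"
proof (intro equalityI subsetI)
  fix z :: "real^'n" assume z: "z \<in> coord_subspace (S \<union> T)"
  let ?x = "\<chi> i. if i \<in> S then z $ i else 0" and ?y = "\<chi> i. if i \<in> S then 0 else z $ i"
  have "z = ?x + ?y" "?x \<in> coord_subspace S" "?y \<in> coord_subspace T"
    using z by (auto simp: coord_subspace_def vec_eq_iff)
  then show "z \<in> {x + y | x y. x \<in> coord_subspace S \<and> y \<in> coord_subspace T}"
    by blast
qed (auto simp: coord_subspace_def)

section \<open>Nonsingular principal submatrices\<close>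

lemma det_ring_hom:
  fixes h :: "'a::comm_ring_1 \<Rightarrow> 'b::comm_ring_1" and A :: "'a^'n^'n"
  assumes h: "h 1 = 1" "\<And>a b. h (a + b) = h a + h b" "\<And>a b. h (a * b) = h a * h b"
  shows "det (\<chi> i j. h (A $ i $ j)) = h (det A)"
proof -
  have h0: "h 0 = 0"
    using h(2)[of 0 0] by simp
  have hm: "h (- a) = - h a" for a
    using h(2)[of a "- a"] h0 by (simp add: eq_neg_iff_add_eq_0 add.commute)
  have hsum: "h (sum f F) = (\<Sum>x\<in>F. h (f x))" for f :: "('n \<Rightarrow> 'n) \<Rightarrow> 'a" and F
    by (induction F rule: infinite_finite_induct) (simp_all add: h0 h(2))
  have hprod: "h (prod f F) = (\<Prod>x\<in>F. h (f x))" for f :: "'n \<Rightarrow> 'a" and F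
    by (induction F rule: infinite_finite_induct) (simp_all add: h)
  have hsign: "h (of_int (sign p)) = of_int (sign p)" for p :: "'n \<Rightarrow> 'n"
    by (simp add: sign_def h hm)
  show ?thesis
    unfolding det_def by (simp add: hsum hprod hsign h(3))
qed

lemma det_add_rows_expand:
  fixes a b :: "'n::finite \<Rightarrow> 'a::comm_ring_1^'n"
  shows "det (\<chi> i. a i + b i) = (\<Sum>V\<in>UNIV. det (\<chi> i. if i \<in> V then a i else b i))"
proof -
  have "(\<Prod>i\<in>UNIV. (a i + b i) $ p i) = (\<Sum>V\<in>UNIV. \<Prod>i\<in>UNIV. (if i \<in> V then a i else b i) $ p i)" for p
  proof -
    have "(\<Prod>i\<in>V. a i $ p i) * (\<Prod>i\<in>UNIV - V. b i $ p i) = (\<Prod>i\<in>UNIV. (if i \<in> V then a i else b i) $ p i)" for V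
    proof -
      have "(\<Prod>i\<in>UNIV. (if i \<in> V then a i else b i) $ p i) =
          (\<Prod>i\<in>UNIV. if i \<in> V then a i $ p i else b i $ p i)"
        by (intro prod.cong) auto
      also have "\<dots> = (\<Prod>i\<in>V. a i $ p i) * (\<Prod>i\<in>UNIV - V. b i $ p i)"
        by (simp add: prod.If_cases Compl_eq_Diff_UNIV)
      finally show ?thesis ..
    qed
    then show ?thesis
      by (simp add: prod_add)
  qed
  then show ?thesis
    unfolding det_def by (simp add: sum_distrib_left sum.swap[of _ _ "UNIV :: 'n set set"])
qed

text \<open>
  A real matrix as a matrix of constant polynomials.
\<close>

definition const_matrix :: "real^'n^'n \<Rightarrow> real poly^'n^'n" where
  "const_matrix M = (\<chi> i j. [:M $ i $ j:])"

text \<open>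
  The polynomial \<open>det (X I + M)\<close>, which is the characteristic polynomial of \<open>- M\<close>.
\<close>

definition pencil_det :: "real^'n^'n \<Rightarrow> real poly" where
  "pencil_det M = det (mat [:0, 1:] + const_matrix M)"

lemma const_matrix_mult:
  fixes A B :: "real^'n^'n"
  shows "const_matrix (A ** B) = const_matrix A ** const_matrix B"
proof -
  have "(\<Sum>x\<in>F. [:f x:]) = [:sum f F:]" for f :: "'n \<Rightarrow> real" and F
    by (induction F rule: infinite_finite_induct) simp_all
  then show ?thesis
    by (simp add: const_matrix_def matrix_matrix_mult_def vec_eq_iff mult.commute)
qed

lemma det_const_matrix: "det (const_matrix M) = [:det M:]"
  unfolding const_matrix_def by (rule det_ring_hom) simp_all

lemma mat_matrix_mult:
  fixes A :: "'a::comm_ring_1^'n^'n"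
  shows "mat c ** A = (\<chi> i j. c * A $ i $ j)" "A ** mat c = (\<chi> i j. c * A $ i $ j)"
  by (simp_all add: matrix_matrix_mult_def mat_def vec_eq_iff if_distrib if_distribR
      mult.commute cong: if_cong)

text \<open>
  The identity \<open>(X I + M) (- X I + M) = - X\<^sup>2 I + M\<^sup>2\<close> in determinants. It relates the order of vanishing
  at \<open>0\<close> for \<open>M\<close> and for \<open>M\<^sup>2\<close>.
\<close>

lemma pencil_det_square:
  fixes M :: "real^'n^'n"
  shows "pencil_det M * pcompose (pencil_det M) [:0, -1:] = pcompose (pencil_det (M ** M)) (- ([:0, 1:] ^ 2))"
proof -
  have comp: "pcompose (pencil_det M) q = det (mat q + const_matrix M)" for q and M :: "real^'n^'n"
  proof -
    have "pcompose (pencil_det M) q =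
        det (\<chi> i j. pcompose ((mat [:0, 1:] + const_matrix M) $ i $ j) q)"
      unfolding pencil_det_def
      by (rule det_ring_hom[where h = "\<lambda>p. pcompose p q", symmetric])
         (simp_all add: pcompose_1 pcompose_add pcompose_mult)
    also have "(\<chi> i j. pcompose ((mat [:0, 1:] + const_matrix M) $ i $ j) q) = mat q + const_matrix M"
      by (simp add: vec_eq_iff mat_def const_matrix_def pcompose_add pcompose_pCons)
    finally show ?thesis .
  qed
  have distrib: "(A + B) ** C = A ** C + B ** C" for A B C :: "real poly^'n^'n"
    by (simp add: matrix_matrix_mult_def vec_eq_iff algebra_simps sum.distrib)
  have "(mat [:0, 1:] + const_matrix M) ** (mat [:0, -1:] + const_matrix M) =
      mat (- ([:0, 1:] ^ 2)) + const_matrix (M ** M)"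
    unfolding matrix_add_ldistrib distrib const_matrix_mult mat_matrix_mult
    by (simp add: vec_eq_iff mat_def power2_eq_square)
  then show ?thesis
    unfolding comp by (simp add: pencil_det_def flip: det_mul)
qed

lemma pencil_det_dvd_square:
  assumes "[:0, 1:] ^ k dvd pencil_det M"
  shows "[:0, 1:] ^ k dvd pencil_det (M ** M)"
proof (cases "pencil_det (M ** M) = 0")
  case False
  let ?X = "[:0, 1:] :: real poly"
  obtain q where q: "pencil_det (M ** M) = ?X ^ order 0 (pencil_det (M ** M)) * q" "\<not> ?X dvd q"
    using order_decomp[OF False, of 0] by auto
  define j where "j = order 0 (pencil_det (M ** M))"
  obtain r where r: "pencil_det M = ?X ^ k * r"
    using assms by blast
  have pow: "pcompose (?X ^ i * p) q = q ^ i * pcompose p q" for i and p q :: "real poly"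
    by (induction i) (simp_all add: pcompose_mult pcompose_pCons mult.assoc)
  have neg: "a dvd (- b) ^ i * c \<longleftrightarrow> a dvd b ^ i * c" for a b c :: "real poly" and i
    by (cases "even i") simp_all
  have "?X ^ (2 * k) dvd ?X ^ k * (?X ^ k * (r * pcompose r [:0, -1:]))"
    by (simp add: mult_2 power_add mult_dvd_mono)
  then have "?X ^ (2 * k) dvd (- ?X) ^ k * (?X ^ k * (r * pcompose r [:0, -1:]))"
    by (simp only: neg)
  also have "(- ?X) ^ k * (?X ^ k * (r * pcompose r [:0, -1:])) =
      pencil_det M * pcompose (pencil_det M) [:0, -1:]"
    unfolding r pow by (simp add: mult_ac)
  also have "\<dots> = (- (?X ^ 2)) ^ j * pcompose q (- (?X ^ 2))"
    unfolding pencil_det_square by (subst q(1)) (simp only: pow j_def)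
  finally have dvd: "?X ^ (2 * k) dvd ?X ^ (2 * j) * pcompose q (- (?X ^ 2))"
    by (simp only: neg power_mult)
  have "k \<le> j"
  proof (rule ccontr)
    assume "\<not> k \<le> j"
    then have "Suc (2 * j) \<le> 2 * k"
      by simp
    then have "?X ^ Suc (2 * j) dvd ?X ^ (2 * j) * pcompose q (- (?X ^ 2))"
      using dvd le_imp_power_dvd dvd_trans by blast
    then have "?X ^ (2 * j) * ?X dvd ?X ^ (2 * j) * pcompose q (- (?X ^ 2))"
      by (simp only: power_Suc2)
    then have "?X dvd pcompose q (- (?X ^ 2))"
      by (subst (asm) dvd_mult_cancel_left) simp
    then have "poly (pcompose q (- (?X ^ 2))) 0 = 0"
      by (auto elim: dvdE)
    then have "poly q 0 = 0"
      by (simp add: poly_pcompose)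
    then show False
      using q(2) poly_eq_0_iff_dvd[of q 0] by simp
  qed
  then show ?thesis
    using q(1) by (metis dvd_mult2 j_def le_imp_power_dvd)
qed simp

text \<open>
  Some change of basis turns a given subspace into a coordinate subspace.
\<close>

lemma flatten_subspace:
  fixes U :: "(real^'n) set"
  assumes "subspace U"
  obtains C :: "real^'n^'n" and J :: "'n set"
  where "det C \<noteq> 0" "card J = dim U" "\<And>x. x \<in> U \<longleftrightarrow> (\<forall>i. i \<notin> J \<longrightarrow> (C *v x) $ i = 0)"
proof -
  obtain B where B: "B \<subseteq> U" "independent B" "U \<subseteq> span B" "card B = dim U"
    using basis_exists by metis
  obtain D where D: "B \<subseteq> D" "independent D" "UNIV \<subseteq> span D"
    using maximal_independent_subset_extend[of B UNIV] B by auto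
  have finD: "finite D"
    using D(2) by (simp add: independent_imp_finite)
  have "card D = CARD('n)"
    using D by (metis basis_card_eq_dim dim_UNIV dim_vec_eq top_greatest vec_dim_card)
  then obtain \<phi> :: "real^'n \<Rightarrow> 'n" where \<phi>: "bij_betw \<phi> D UNIV"
    using finD finite_same_card_bij[of D "UNIV :: 'n set"] by auto
  obtain c :: "real^'n \<Rightarrow> real^'n" where c: "linear c" "\<And>x. x \<in> D \<Longrightarrow> c x = axis (\<phi> x) 1"
    using linear_independent_extend[OF D(2), of "\<lambda>x. axis (\<phi> x) 1"] by auto
  define C where "C = matrix c"
  have C: "C *v x = c x" for x
    unfolding C_def using c(1) by (simp add: matrix_works)
  define J where "J = \<phi> ` B"
  have injB: "inj_on \<phi> B"
    using \<phi> D(1) by (meson bij_betw_imp_inj_on inj_on_subset)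
  have cB: "c ` B = (\<lambda>i. axis i 1) ` J"
    using c(2) D(1) by (auto simp: J_def image_image intro!: image_cong)
  have indep_axis: "independent ((\<lambda>i. axis i 1 :: real^'n) ` I)" for I
    by (rule independent_mono[OF independent_Basis]) (auto simp: Basis_vec_def)
  have "inj_on c (span D)"
  proof (rule linear_inj_on_span_independent_image[OF c(1)])
    have "c ` D = (\<lambda>i. axis i 1) ` \<phi> ` D"
      using c(2) by (auto simp: image_image intro!: image_cong)
    then show "independent (c ` D)"
      using indep_axis by simp
    show "inj_on c D"
      using \<phi> c(2) by (auto simp: inj_on_def axis_eq_axis bij_betw_def)
  qed
  then have injc: "inj c"
    using D(3) by (simp add: top.extremum_unique)
  then have "inj ((*v) C)"
    by (simp add: C inj_on_def)
  then have "det C \<noteq> 0"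
    by (metis invertible_det_nz invertible_left_inverse matrix_left_invertible_injective)
  moreover have "card J = dim U"
    using B(4) injB by (simp add: J_def card_image)
  moreover have "x \<in> U \<longleftrightarrow> (\<forall>i. i \<notin> J \<longrightarrow> (C *v x) $ i = 0)" for x
  proof -
    let ?E = "coord_subspace J"
    have subE: "subspace ?E"
      by (rule subspace_coord_subspace)
    have "U = span B"
      using B assms span_minimal by blast
    have cU: "c ` U \<subseteq> ?E"
      unfolding \<open>U = span B\<close> linear_span_image[OF c(1), symmetric] cB
      by (intro span_minimal subE) (auto simp: axis_def coord_subspace_def)
    have "dim (c ` U) = dim U"
      using c(1) injc by (metis dim_image_eq inj_on_subset subset_UNIV)
    then have "c ` U = ?E"
      using cU dim_coord_subspace[of J] \<open>card J = dim U\<close>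
      by (intro subspace_dim_equal subE linear_subspace_image[OF c(1)] assms) auto
    then have "x \<in> U \<longleftrightarrow> c x \<in> ?E"
      using injc by (metis inj_image_mem_iff)
    then show ?thesis
      by (simp add: C coord_subspace_def)
  qed
  ultimately show ?thesis
    using that by blast
qed

text \<open>
  If the kernel and the range of \<open>L\<close> meet only in \<open>0\<close>, then \<open>0\<close> is a root of order at most \<open>n - rank L\<close>.
\<close>

lemma pencil_det_index_one:
  fixes L :: "real^'n^'n"
  assumes "\<And>x. L *v (L *v x) = 0 \<Longrightarrow> L *v x = 0"
  shows "\<not> [:0, 1:] ^ (CARD('n) - rank L + 1) dvd pencil_det L"
proof
  let ?X = "[:0, 1:] :: real poly"
  assume dvd: "?X ^ (CARD('n) - rank L + 1) dvd pencil_det L"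
  obtain C :: "real^'n^'n" and J :: "'n set" where C: "det C \<noteq> 0" "card J = dim (range ((*v) L))"
    and J: "\<And>x. x \<in> range ((*v) L) \<longleftrightarrow> (\<forall>i. i \<notin> J \<longrightarrow> (C *v x) $ i = 0)"
    using flatten_subspace[of "range ((*v) L)"] by (metis matrix_vector_mul_linear linear_subspace_image subspace_UNIV)
  have CL0: "(C ** L) $ i $ j = 0" if "i \<notin> J" for i j
  proof -
    have "(C *v (L *v axis j 1)) $ i = 0"
      using J that by blast
    then show ?thesis
      unfolding matrix_vector_mult_basis column_def
      by (simp add: matrix_vector_mult_def matrix_matrix_mult_def)
  qed
  \<comment> \<open>\<open>C\<close> maps the range of \<open>L\<close> to the coordinate subspace of \<open>J\<close>, so each of the \<open>n - rank L\<close>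
      rows of \<open>C (X I + L)\<close> outside \<open>J\<close> has a factor \<open>X\<close>. Without these factors the matrix is \<open>G\<close>,
      which is nonsingular at \<open>X = 0\<close>.\<close>
  define G where "G = (\<chi> i j. if i \<in> J then ?X * [:C $ i $ j:] + [:(C ** L) $ i $ j:] else [:C $ i $ j:])"
  have "const_matrix C ** (mat ?X + const_matrix L) = (\<chi> i. (if i \<in> J then 1 else ?X) *s G $ i)"
    unfolding matrix_add_ldistrib mat_matrix_mult const_matrix_mult[symmetric]
    by (simp add: vec_eq_iff G_def const_matrix_def CL0)
  then have "[:det C:] * pencil_det L = (\<Prod>i\<in>UNIV. if i \<in> J then 1 else ?X) * det G"
    unfolding pencil_det_def det_const_matrix[symmetric] det_mul[symmetric]
    by (simp add: det_rows_mul)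
  also have "(\<Prod>i\<in>UNIV. if i \<in> J then 1 else ?X) = ?X ^ (CARD('n) - rank L)"
    using C(2) by (simp add: prod.If_cases Compl_eq_Diff_UNIV card_Diff_subset rank_dim_range)
  finally have "?X ^ (CARD('n) - rank L) * ?X dvd ?X ^ (CARD('n) - rank L) * det G"
    using dvd by (metis Suc_eq_plus1 dvd_mult power_Suc2)
  then have "?X dvd det G"
    by (subst (asm) dvd_mult_cancel_left) simp
  then have "poly (det G) 0 = 0"
    by (auto elim: dvdE)
  moreover have "poly (det G) 0 = det (\<chi> i j. poly (G $ i $ j) 0)"
    by (rule det_ring_hom[symmetric]) simp_all
  moreover have "(\<chi> i j. poly (G $ i $ j) 0) = (\<chi> i. if i \<in> J then (C ** L) $ i else C $ i)"
    by (simp add: vec_eq_iff G_def)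
  ultimately have "det (\<chi> i. if i \<in> J then (C ** L) $ i else C $ i) = 0"
    by simp
  then obtain x where x: "x \<noteq> 0" "(\<chi> i. if i \<in> J then (C ** L) $ i else C $ i) *v x = 0"
    by (metis invertible_det_nz invertible_left_inverse matrix_left_invertible_ker)
  have row: "(if i \<in> J then ((C ** L) *v x) $ i else (C *v x) $ i) = 0" for i
    using x(2) by (auto simp: vec_eq_iff matrix_vector_mult_def dest!: spec[of _ i] split: if_splits)
  have "((C ** L) *v x) $ i = 0" for i
    using row[of i] by (cases "i \<in> J") (simp_all add: matrix_vector_mult_def CL0)
  then have "C *v (L *v x) = 0"
    by (simp add: vec_eq_iff matrix_vector_mul_assoc)
  then have "L *v x = 0"
    using C(1) by (metis invertible_det_nz invertible_left_inverse matrix_left_invertible_ker)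
  have "\<forall>i. i \<notin> J \<longrightarrow> (C *v x) $ i = 0"
    using row by metis
  then obtain y where "x = L *v y"
    using J by blast
  with assms[of y] \<open>L *v x = 0\<close> x(1) show False
    by simp
qed

text \<open>
  Squaring \<open>M\<close> preserves \<open>M ` W = W\<close> as well as divisibility by powers of \<open>X\<close>. Repeated squaring
  lowers the rank until the kernel and the range meet only in \<open>0\<close>.
\<close>

lemma not_dvd_pencil_det:
  fixes M :: "real^'n^'n"
  assumes "(*v) M ` W = W" "subspace W"
  shows "\<not> [:0, 1:] ^ (CARD('n) - dim W + 1) dvd pencil_det M"
  using assms(1)
proof (induction "rank M" arbitrary: M rule: less_induct)
  case less
  let ?R = "range ((*v) M)"
  have "W \<subseteq> ?R"
    using less.prems by blast
  then have le: "dim W \<le> rank M"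
    unfolding rank_dim_range by (rule dim_subset)
  have subR: "subspace ?R"
    by (simp add: linear_subspace_image)
  show ?case
  proof (cases "rank (M ** M) < rank M")
    case True
    have "(*v) (M ** M) ` W = (*v) M ` (*v) M ` W"
      by (simp add: image_image matrix_vector_mul_assoc)
    then have "(*v) (M ** M) ` W = W"
      using less.prems by simp
    then show ?thesis
      using less.hyps[OF True] pencil_det_dvd_square by blast
  next
    case False
    obtain B where B: "B \<subseteq> ?R" "independent B" "?R \<subseteq> span B" "card B = dim ?R"
      by (rule basis_exists)
    have finB: "finite B"
      using B(2) by (simp add: independent_imp_finite)
    have R2: "range ((*v) (M ** M)) = (*v) M ` ?R"
      by (auto simp: image_image matrix_vector_mul_assoc)
    have "(*v) M ` ?R = ?R"
      using False subR R2 unfolding rank_dim_range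
      by (intro subspace_dim_equal linear_subspace_image) auto
    moreover have "?R = span B"
      using B subR span_minimal by blast
    ultimately have spanR: "span ((*v) M ` B) = ?R"
      by (metis linear_span_image matrix_vector_mul_linear)
    have "dim ?R \<le> card ((*v) M ` B)"
      by (rule dim_le_card) (simp_all add: spanR finB)
    then have card: "card ((*v) M ` B) = card B"
      using B(4) card_image_le[OF finB, of "(*v) M"] by simp
    then have "inj_on ((*v) M) B"
      using finB by (metis eq_card_imp_inj_on)
    moreover have "independent ((*v) M ` B)"
    proof (rule card_le_dim_spanning[of _ ?R])
      show "(*v) M ` B \<subseteq> ?R" by blast
      show "?R \<subseteq> span ((*v) M ` B)" by (simp only: spanR order_refl)
    qed (use finB card B(4) in auto)
    ultimately have inj: "inj_on ((*v) M) ?R"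
      using \<open>?R = span B\<close> by (metis linear_inj_on_span_independent_image matrix_vector_mul_linear)
    have "\<not> [:0, 1:] ^ (CARD('n) - rank M + 1) dvd pencil_det M"
    proof (rule pencil_det_index_one)
      fix x assume "M *v (M *v x) = 0"
      then have "M *v (M *v x) = M *v (M *v 0)" by simp
      then show "M *v x = 0"
        using inj by (metis inj_on_def matrix_vector_mult_0_right rangeI)
    qed
    then show ?thesis
      using le by (meson add_le_cancel_right diff_le_mono2 dvd_trans le_imp_power_dvd)
  qed
qed

text \<open>
  Replacing the rows outside \<open>V\<close> by unit vectors leaves the determinant of the principal submatrix
  with index set \<open>V\<close>. Expanding \<open>det (X I + M)\<close> by rows gives the sum of these determinants times
  \<open>X ^ card (- V)\<close>.
\<close>

lemma principal_minor_of_invariant_subspace: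
  fixes M :: "real^'n^'n"
  assumes "(*v) M ` W = W" "subspace W"
  obtains V where "dim W \<le> card V" "det (\<chi> i. if i \<in> V then M $ i else axis i 1) \<noteq> 0"
proof -
  let ?X = "[:0, 1:] :: real poly"
  let ?D = "\<lambda>V. \<chi> i. if i \<in> V then M $ i else axis i 1"
  have expand: "pencil_det M = (\<Sum>V\<in>UNIV. ?X ^ card (- V) * [:det (?D V):])"
  proof -
    have "pencil_det M = det (\<chi> i. const_matrix M $ i + mat ?X $ i)"
      unfolding pencil_det_def by (rule arg_cong[where f = det]) (simp add: vec_eq_iff add.commute)
    also have "\<dots> = (\<Sum>V\<in>UNIV. det (\<chi> i. if i \<in> V then const_matrix M $ i else mat ?X $ i))"
      by (rule det_add_rows_expand)
    also have "\<dots> = (\<Sum>V\<in>UNIV. ?X ^ card (- V) * [:det (?D V):])"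
    proof (rule sum.cong[OF refl])
      fix V :: "'n set"
      have "(\<chi> i. if i \<in> V then const_matrix M $ i else mat ?X $ i) =
          (\<chi> i. (if i \<in> V then 1 else ?X) *s const_matrix (?D V) $ i)"
        by (simp add: vec_eq_iff const_matrix_def mat_def axis_def)
      then have "det (\<chi> i. if i \<in> V then const_matrix M $ i else mat ?X $ i) =
          (\<Prod>i\<in>UNIV. if i \<in> V then 1 else ?X) * det (const_matrix (?D V))"
        by (simp add: det_rows_mul)
      then show "det (\<chi> i. if i \<in> V then const_matrix M $ i else mat ?X $ i) = ?X ^ card (- V) * [:det (?D V):]"
        by (simp add: prod.If_cases det_const_matrix)
    qed
    finally show ?thesis .
  qed
  have "\<exists>V. dim W \<le> card V \<and> det (?D V) \<noteq> 0"
  proof (rule ccontr)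
    assume none: "\<nexists>V. dim W \<le> card V \<and> det (?D V) \<noteq> 0"
    have "?X ^ (CARD('n) - dim W + 1) dvd pencil_det M"
      unfolding expand
    proof (rule dvd_sum)
      fix V :: "'n set"
      show "?X ^ (CARD('n) - dim W + 1) dvd ?X ^ card (- V) * [:det (?D V):]"
      proof (cases "det (?D V) = 0")
        case False
        then have "card V < dim W"
          using none by (meson linorder_not_le)
        moreover have "dim W \<le> CARD('n)"
          by (metis dim_subset_UNIV DIM_cart DIM_real mult.right_neutral)
        ultimately have "CARD('n) - dim W + 1 \<le> card (- V)"
          by (simp add: Compl_eq_Diff_UNIV card_Diff_subset)
        then show ?thesis
          by (intro dvd_mult2 le_imp_power_dvd)
      qed simp
    qed
    then show False
      using not_dvd_pencil_det[OF assms] by blast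
  qed
  then show ?thesis
    using that by blast
qed

section \<open>Closed-loop matrices\<close>

text \<open>
  The matrix \<open>D A + B\<^sub>S K\<close>, where \<open>D\<close> is the diagonal matrix with entries \<open>d\<close> and \<open>B\<^sub>S\<close> is the diagonal
  indicator matrix of \<open>S\<close>: a feedback \<open>K\<close> through the inputs in \<open>S\<close>, for the row-scaled matrix \<open>D A\<close>.
\<close>

definition closed_loop :: "real^'n^'n \<Rightarrow> 'n set \<Rightarrow> real^'n \<Rightarrow> real^'n^'n \<Rightarrow> real^'n^'n" where
  "closed_loop A S d K = (\<chi> i j. d $ i * A $ i $ j + (if i \<in> S then K $ i $ j else 0))"

text \<open>
  The matrix \<open>D A\<close>, where \<open>D\<close> is the diagonal matrix with entries \<open>d\<close>.
\<close>

definition scale_rows :: "real^'n \<Rightarrow> real^'n^'n \<Rightarrow> real^'n^'n" where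
  "scale_rows d A = (\<chi> i j. d $ i * A $ i $ j)"

text \<open>
  The power \<open>M\<^sup>k\<close>.
\<close>

definition matrix_pow :: "real^'n^'n \<Rightarrow> nat \<Rightarrow> real^'n^'n" where
  "matrix_pow M k = ((\<lambda>X. M ** X) ^^ k) (mat 1)"

lemma scale_rows_mult: "(scale_rows d A *v x) $ i = d $ i * (A *v x) $ i"
  by (simp add: scale_rows_def matrix_vector_mult_def sum_distrib_left mult.assoc)

lemma closed_loop_mult:
  "(closed_loop A S d K *v x) $ i = (scale_rows d A *v x) $ i + (if i \<in> S then (K *v x) $ i else 0)"
  by (simp add: closed_loop_def scale_rows_def matrix_vector_mult_def distrib_right sum.distrib)

lemma matrix_pow_mult: "matrix_pow M k *v x = ((*v) M ^^ k) x"
  by (induction k) (simp_all add: matrix_pow_def flip: matrix_vector_mul_assoc)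

lemma real_polynomial_function_matrix_pow:
  fixes X :: "'p::real_normed_vector \<Rightarrow> real^'n^'n"
  assumes "\<And>i j. real_polynomial_function (\<lambda>p. X p $ i $ j)"
  shows "real_polynomial_function (\<lambda>p. matrix_pow (X p) k $ i $ j)"
proof (induction k arbitrary: i j)
  case 0
  show ?case
    by (simp add: matrix_pow_def real_polynomial_function.intros(2))
next
  case (Suc k)
  have "matrix_pow (X p) (Suc k) = X p ** matrix_pow (X p) k" for p
    by (simp add: matrix_pow_def)
  then show ?case
    using real_polynomial_function_matrix_mult[OF assms Suc] by simp
qed

lemma rank_matrix_pow_ge:
  fixes M :: "real^'n^'n"
  assumes "(*v) M ` W = W"
  shows "dim W \<le> rank (matrix_pow M k)"
proof -
  have "((*v) M ^^ k) ` W = W"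
    using assms by (induction k) (simp_all add: image_comp flip: image_image)
  then have "W \<subseteq> range ((*v) (matrix_pow M k))"
    unfolding matrix_pow_mult by (metis image_mono top_greatest)
  then show ?thesis
    unfolding rank_dim_range by (rule dim_subset)
qed

lemma rank_closed_loop_pow_le:
  "rank (matrix_pow (closed_loop A S d K) k)
    \<le> dim (reach_space ((*v) (scale_rows d A)) (coord_subspace S) k)"
proof -
  let ?K = "\<lambda>x. \<chi> i. if i \<in> S then (K *v x) $ i else 0"
  have "(*v) (closed_loop A S d K) = (\<lambda>x. scale_rows d A *v x + ?K x)"
    by (simp add: fun_eq_iff vec_eq_iff closed_loop_mult)
  moreover have "range ?K \<subseteq> coord_subspace S"
    by (auto simp: coord_subspace_def)
  ultimately have "range ((*v) (matrix_pow (closed_loop A S d K) k))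
      \<subseteq> reach_space ((*v) (scale_rows d A)) (coord_subspace S) k"
    using funpow_in_reach_space[where K = ?K and E = "coord_subspace S" and N = "(*v) (scale_rows d A)" and k = k]
    by (auto simp: matrix_pow_mult)
  then show ?thesis
    unfolding rank_dim_range by (rule dim_subset)
qed

lemma closed_loop_surjective_on:
  fixes A :: "real^'n^'n"
  assumes W: "subspace W"
    and eq: "W = {scale_rows d A *v x + e | x e. x \<in> W \<and> e \<in> E}"
    and E: "subspace E" "E \<subseteq> coord_subspace S"
  obtains K where "(*v) (closed_loop A S d K) ` W = W"
proof -
  obtain k where k: "linear k" "range k \<subseteq> E" "(\<lambda>x. scale_rows d A *v x + k x) ` W = W"
    using feedback_surjective_on[OF matrix_vector_mul_linear W E(1) eq] .
  have "k x $ i = 0" if "i \<notin> S" for x i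
    using k(2) E(2) that by (force simp: coord_subspace_def)
  then have "(*v) (closed_loop A S d (matrix k)) = (\<lambda>x. scale_rows d A *v x + k x)"
    using k(1) by (auto simp: fun_eq_iff vec_eq_iff closed_loop_mult matrix_works)
  then show ?thesis
    using that k(3) by metis
qed

section \<open>The rank condition in the first index\<close>

text \<open>
  The matrix \<open>(A(V) | B(V))\<close> for \<open>B = T\<^sub>B(S)\<close> with parameters \<open>\<beta>\<close>.
\<close>

abbreviation aug :: "'n set \<Rightarrow> real^'n^'n \<Rightarrow> 'n set \<Rightarrow> real^'n \<Rightarrow> real^('n + 'n)^'n" where
  "aug V A S \<beta> \<equiv> augment_cols (principal_submatrix V A) (principal_submatrix V (input_matrix S \<beta>))"

lemma augment_cols_mult:
  "augment_cols M N *v z = M *v (\<chi> j. z $ Inl j) + N *v (\<chi> j. z $ Inr j)"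
  by (simp add: vec_eq_iff augment_cols_def matrix_vector_mult_def UNIV_Plus_UNIV[symmetric] sum.Plus
      del: UNIV_Plus_UNIV)

lemma principal_submatrix_mult:
  assumes "x \<in> coord_subspace V"
  shows "(principal_submatrix V A *v x) $ i = (if i \<in> V then (A *v x) $ i else 0)"
proof -
  have "x $ j = 0" if "j \<notin> V" for j
    using assms that by (simp add: coord_subspace_def)
  then show ?thesis
    by (auto simp: principal_submatrix_def matrix_vector_mult_def intro!: sum.cong)
qed

lemma principal_submatrix_mult_restrict:
  "principal_submatrix V A *v x = principal_submatrix V A *v (\<chi> i. if i \<in> V then x $ i else 0)"
  by (auto simp: vec_eq_iff principal_submatrix_def matrix_vector_mult_def intro!: sum.cong)

lemma input_block_mult:
  "(principal_submatrix V (input_matrix S \<beta>) *v y) $ i = (if i \<in> V \<inter> S then \<beta> $ i * y $ i else 0)"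
proof -
  have "(principal_submatrix V (input_matrix S \<beta>) *v y) $ i
      = (\<Sum>j\<in>UNIV. if j = i then (if i \<in> V \<inter> S then \<beta> $ i * y $ i else 0) else 0)"
    unfolding matrix_vector_mult_def vec_lambda_beta
    by (intro sum.cong) (auto simp: principal_submatrix_def input_matrix_def)
  then show ?thesis
    by simp
qed

lemma range_aug_subset: "range ((*v) (aug V A S \<beta>)) \<subseteq> coord_subspace V"
proof -
  have "(principal_submatrix V M *v x) $ i = 0" if "i \<notin> V" for M x i
    using that by (simp add: principal_submatrix_def matrix_vector_mult_def)
  then show ?thesis
    by (auto simp: coord_subspace_def augment_cols_mult)
qed

lemma rank_aug_le: "rank (aug V A S \<beta>) \<le> card V"
  using dim_subset[OF range_aug_subset] by (simp add: rank_dim_range dim_coord_subspace)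

lemma range_aug:
  assumes "rank (aug V A S \<beta>) = card V"
  shows "range ((*v) (aug V A S \<beta>)) = coord_subspace V"
  using assms
  by (intro subspace_dim_equal range_aug_subset subspace_coord_subspace)
     (simp_all add: linear_subspace_image rank_dim_range dim_coord_subspace)

text \<open>
  For the indicator \<open>d\<close> of \<open>V\<close>, the rank condition says that the coordinate subspace of \<open>V\<close> is the sum of
  its image under \<open>D A\<close> and the coordinate subspace of \<open>V \<inter> S\<close>.
\<close>

lemma closed_loop_of_full_rank:
  fixes A :: "real^'n^'n"
  assumes "rank (aug V A S \<beta>) = card V"
  obtains d K where "card V \<le> rank (matrix_pow (closed_loop A S d K) k)"
proof -
  let ?W = "coord_subspace V" and ?E = "coord_subspace (V \<inter> S)"
  define d :: "real^'n" where "d = (\<chi> i. if i \<in> V then 1 else 0)"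
  have scale: "scale_rows d A *v x = principal_submatrix V A *v x" if "x \<in> ?W" for x
    using that by (simp add: vec_eq_iff scale_rows_mult principal_submatrix_mult d_def)
  have "?W = {scale_rows d A *v x + e | x e. x \<in> ?W \<and> e \<in> ?E}"
  proof (intro equalityI subsetI)
    fix w assume "w \<in> ?W"
    then obtain z where "w = aug V A S \<beta> *v z"
      using range_aug[OF assms] by blast
    then obtain x y where w: "w = principal_submatrix V A *v x + principal_submatrix V (input_matrix S \<beta>) *v y"
      unfolding augment_cols_mult by blast
    let ?x = "\<chi> i. if i \<in> V then x $ i else 0"
    have "?x \<in> ?W"
      by (simp add: coord_subspace_def)
    moreover from this have "w = scale_rows d A *v ?x + principal_submatrix V (input_matrix S \<beta>) *v y"
      using w principal_submatrix_mult_restrict scale by metis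
    moreover have "principal_submatrix V (input_matrix S \<beta>) *v y \<in> ?E"
      by (simp add: coord_subspace_def input_block_mult)
    ultimately show "w \<in> {scale_rows d A *v x + e | x e. x \<in> ?W \<and> e \<in> ?E}"
      by blast
  next
    fix w assume "w \<in> {scale_rows d A *v x + e | x e. x \<in> ?W \<and> e \<in> ?E}"
    then show "w \<in> ?W"
      by (auto simp: coord_subspace_def scale_rows_mult d_def)
  qed
  moreover have "?E \<subseteq> coord_subspace S"
    by (auto simp: coord_subspace_def)
  ultimately obtain K where "(*v) (closed_loop A S d K) ` ?W = ?W"
    using closed_loop_surjective_on[OF subspace_coord_subspace _ subspace_coord_subspace] by blast
  then show ?thesis
    using that rank_matrix_pow_ge dim_coord_subspace by metis
qed

text \<open>
  The index set \<open>V\<close> is that of a nonsingular principal submatrix of the closed-loop matrix. Its rows in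
  \<open>V - S\<close> are nonzero multiples of rows of \<open>A(V)\<close>, so prescribed values of \<open>A(V) x\<close> in these rows are
  attained by solving a system with this submatrix. The values in \<open>V \<inter> S\<close> are then corrected
  through the inputs.
\<close>

lemma full_rank_of_closed_loop:
  fixes A :: "real^'n^'n"
  assumes "(*v) (closed_loop A S d K) ` W = W" "subspace W"
  obtains V where "dim W \<le> card V" "rank (aug V A S (\<chi> i. 1)) = card V"
proof -
  let ?M = "closed_loop A S d K"
  obtain V where V: "dim W \<le> card V" "det (\<chi> i. if i \<in> V then ?M $ i else axis i 1) \<noteq> 0"
    using principal_minor_of_invariant_subspace[OF assms] .
  define R where "R = (\<chi> i. if i \<in> V then ?M $ i else axis i 1)"
  have Rmult: "(R *v x) $ i = (if i \<in> V then (?M *v x) $ i else x $ i)" for x i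
  proof -
    have "(\<Sum>j\<in>UNIV. axis i 1 $ j * x $ j) = (\<Sum>j\<in>UNIV. if j = i then x $ i else 0)"
      by (intro sum.cong) (auto simp: axis_def)
    then show ?thesis
      by (simp add: R_def matrix_vector_mult_def)
  qed
  have "invertible R"
    using V(2) by (simp add: R_def invertible_det_nz)
  then have surj: "surj ((*v) R)"
    by (simp add: invertible_right_inverse matrix_right_invertible_surjective)
  \<comment> \<open>Otherwise row \<open>i\<close> of the invertible matrix \<open>R\<close> would vanish.\<close>
  have d: "d $ i \<noteq> 0" if "i \<in> V" "i \<notin> S" for i
  proof
    assume "d $ i = 0"
    obtain x where "axis i 1 = R *v x"
      using surj by (rule surjE)
    then have "(R *v x) $ i = 1"
      by (metis axis_nth)
    then show False
      using that \<open>d $ i = 0\<close> by (simp add: Rmult closed_loop_mult scale_rows_mult)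
  qed
  have "coord_subspace V \<subseteq> range ((*v) (aug V A S (\<chi> i. 1)))"
  proof
    fix w assume w: "w \<in> coord_subspace V"
    obtain x where x: "(\<chi> i. if i \<in> V then d $ i * w $ i else 0) = R *v x"
      using surj by (rule surjE)
    have xi: "(if i \<in> V then (?M *v x) $ i else x $ i) = (if i \<in> V then d $ i * w $ i else 0)" for i
      using Rmult[of x i] by (simp flip: x)
    have "x $ i = 0" if "i \<notin> V" for i
      using xi[of i] that by simp
    then have xV: "x \<in> coord_subspace V"
      by (simp add: coord_subspace_def)
    define y where "y = w - principal_submatrix V A *v x"
    have "w = principal_submatrix V A *v x + principal_submatrix V (input_matrix S (\<chi> i. 1)) *v y"
    proof (rule vec_eq_iff[THEN iffD2], rule allI)
      fix i
      consider "i \<notin> V" | "i \<in> V" "i \<in> S" | "i \<in> V" "i \<notin> S" by blast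
      then show "w $ i = (principal_submatrix V A *v x + principal_submatrix V (input_matrix S (\<chi> i. 1)) *v y) $ i"
      proof cases
        case 1
        then show ?thesis
          using w by (simp add: input_block_mult principal_submatrix_mult[OF xV] coord_subspace_def)
      next
        case 2
        then show ?thesis
          by (simp add: input_block_mult y_def)
      next
        case 3
        then have "d $ i * (A *v x) $ i = d $ i * w $ i"
          using xi[of i] by (simp add: closed_loop_mult scale_rows_mult)
        then show ?thesis
          using 3 d by (simp add: input_block_mult principal_submatrix_mult[OF xV])
      qed
    qed
    then have "w = aug V A S (\<chi> i. 1) *v (\<chi> k. case k of Inl j \<Rightarrow> x $ j | Inr j \<Rightarrow> y $ j)"
      by (simp add: augment_cols_mult)
    then show "w \<in> range ((*v) (aug V A S (\<chi> i. 1)))"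
      by blast
  qed
  then have "card V \<le> rank (aug V A S (\<chi> i. 1))"
    unfolding rank_dim_range dim_coord_subspace[symmetric] by (rule dim_subset)
  then have "rank (aug V A S (\<chi> i. 1)) = card V"
    using rank_aug_le by (metis le_antisym)
  then show ?thesis
    using that V(1) by blast
qed

lemma generically_full_rank:
  fixes QA :: "real^'n^'n"
  assumes "rank (aug V (QA + structure_matrix TA \<theta>') S \<beta>') = card V"
  shows "generically (\<lambda>(\<theta>, \<beta>). rank (aug V (QA + structure_matrix TA \<theta>) S \<beta>) = card V)"
proof -
  let ?X = "\<lambda>p. aug V (QA + structure_matrix TA (fst p)) S (snd p)"
  have "real_polynomial_function (\<lambda>p. ?X p $ i $ k)" for i k
  proof (cases k)
    case (Inl j)
    have "real_polynomial_function (\<lambda>p :: (real^'n^'n) \<times> (real^'n). fst p $ i $ j)"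
      by (intro real_polynomial_function.intros(1) bounded_linear_compose[OF bounded_linear_vec_nth]
          bounded_linear_fst)
    then show ?thesis
      unfolding Inl augment_cols_def principal_submatrix_def structure_matrix_def
        vec_lambda_beta sum.case vector_add_component
      by (intro real_polynomial_function_if real_polynomial_function.intros(2,3))
  next
    case (Inr j)
    have "real_polynomial_function (\<lambda>p :: (real^'n^'n) \<times> (real^'n). snd p $ i)"
      by (intro real_polynomial_function.intros(1) bounded_linear_compose[OF bounded_linear_vec_nth]
          bounded_linear_snd)
    then show ?thesis
      unfolding Inr augment_cols_def principal_submatrix_def input_matrix_def
        vec_lambda_beta sum.case
      by (intro real_polynomial_function_if real_polynomial_function.intros(2))
  qed
  then have "generically (\<lambda>p. card V \<le> rank (?X p))"
    by (rule generically_rank_ge[where ?p0.0 = "(\<theta>', \<beta>')"]) (simp add: assms)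
  then show ?thesis
    by (rule generically_mono) (auto intro: le_antisym rank_aug_le)
qed

section \<open>Submodularity of the first index\<close>

lemma finite_c1_set: "finite {card V' | V' :: 'n::finite set. P V'}"
  by (rule finite_subset[of _ "range card"]) auto

lemma c1_attained:
  obtains V where "c1 QA TA S = card V"
    "generically (\<lambda>(\<theta>, \<beta>). rank (aug V (QA + structure_matrix TA \<theta>) S \<beta>) = card V)"
proof -
  let ?P = "\<lambda>V. generically (\<lambda>(\<theta>, \<beta>). rank (aug V (QA + structure_matrix TA \<theta>) S \<beta>) = card V)"
  have "?P {}"
    using rank_aug_le[of "{}" "QA + structure_matrix TA 0" S 0]
    by (intro generically_full_rank[where \<theta>' = 0 and \<beta>' = 0]) simp
  then have "{card V | V. ?P V} \<noteq> {}"
    by blast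
  then have "c1 QA TA S \<in> {card V | V. ?P V}"
    unfolding c1_def by (intro Max_in finite_c1_set)
  then show ?thesis
    using that by blast
qed

lemma c1_ge:
  assumes "rank (aug V (QA + structure_matrix TA \<theta>) S \<beta>) = card V"
  shows "card V \<le> c1 QA TA S"
  unfolding c1_def using generically_full_rank[OF assms] by (intro Max_ge finite_c1_set) blast

lemma dim_reach_space_le_c1:
  fixes QA :: "real^'n^'n"
  shows "dim (reach_space ((*v) (scale_rows d (QA + structure_matrix TA \<theta>))) (coord_subspace S) CARD('n)) \<le> c1 QA TA S"
proof -
  let ?A = "QA + structure_matrix TA \<theta>"
  let ?W = "reach_space ((*v) (scale_rows d ?A)) (coord_subspace S) CARD('n)"
  have sub: "subspace ?W"
    by (rule subspace_reach_space) (simp_all add: subspace_coord_subspace)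
  have "?W = {scale_rows d ?A *v x + e | x e. x \<in> ?W \<and> e \<in> coord_subspace S}"
    using reach_space_stable[of "(*v) (scale_rows d ?A)" "coord_subspace S"]
    by (simp add: subspace_coord_subspace)
  then obtain K where "(*v) (closed_loop ?A S d K) ` ?W = ?W"
    using closed_loop_surjective_on[OF sub _ subspace_coord_subspace order_refl] by blast
  then obtain V where "dim ?W \<le> card V" "rank (aug V ?A S (\<chi> i. 1)) = card V"
    using full_rank_of_closed_loop[OF _ sub] by blast
  then show ?thesis
    using c1_ge le_trans by blast
qed

text \<open>
  The scaling \<open>d\<close> and the feedback \<open>K\<close> are now the parameters.
\<close>

lemma generically_closed_loop_rank:
  fixes A :: "real^'n^'n"
  assumes "k \<le> rank (matrix_pow (closed_loop A S d0 K0) m)"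
  shows "generically (\<lambda>(d, K). k \<le> rank (matrix_pow (closed_loop A S d K) m))"
proof -
  let ?X = "\<lambda>p. matrix_pow (closed_loop A S (fst p) (snd p)) m"
  have "real_polynomial_function (\<lambda>p :: (real^'n) \<times> (real^'n^'n). fst p $ i)"
    "real_polynomial_function (\<lambda>p :: (real^'n) \<times> (real^'n^'n). snd p $ i $ j)" for i j
    by (intro real_polynomial_function.intros(1) bounded_linear_compose[OF bounded_linear_vec_nth]
        bounded_linear_fst bounded_linear_snd)+
  then have "real_polynomial_function (\<lambda>p. closed_loop A S (fst p) (snd p) $ i $ j)" for i j
    unfolding closed_loop_def vec_lambda_beta
    by (intro real_polynomial_function_if real_polynomial_function.intros(2,3,4))
  then have "real_polynomial_function (\<lambda>p. ?X p $ i $ j)" for i j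
    by (rule real_polynomial_function_matrix_pow)
  then have "generically (\<lambda>p. k \<le> rank (?X p))"
    by (rule generically_rank_ge[where ?p0.0 = "(d0, K0)"]) (simp add: assms)
  then show ?thesis
    by (rule generically_mono) auto
qed

lemma submodular_c1:
  fixes QA :: "real^'n^'n"
  shows "submodular (c1 QA TA)"
  unfolding submodular_def
proof (intro allI)
  fix S T :: "'n set"
  let ?A = "\<lambda>\<theta>. QA + structure_matrix TA \<theta>"
  obtain V1 where V1: "c1 QA TA (S \<union> T) = card V1"
      "generically (\<lambda>(\<theta>, \<beta>). rank (aug V1 (?A \<theta>) (S \<union> T) \<beta>) = card V1)"
    by (rule c1_attained)
  obtain V2 where V2: "c1 QA TA (S \<inter> T) = card V2"
      "generically (\<lambda>(\<theta>, \<beta>). rank (aug V2 (?A \<theta>) (S \<inter> T) \<beta>) = card V2)"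
    by (rule c1_attained)
  obtain \<theta> \<beta> where full: "rank (aug V1 (?A \<theta>) (S \<union> T) \<beta>) = card V1"
      "rank (aug V2 (?A \<theta>) (S \<inter> T) \<beta>) = card V2"
    using generically_ex[OF generically_conj[OF V1(2) V2(2)]] by auto
  let ?N = "CARD('n)"
  obtain d1 K1 where "card V1 \<le> rank (matrix_pow (closed_loop (?A \<theta>) (S \<union> T) d1 K1) ?N)"
    using closed_loop_of_full_rank[OF full(1)] .
  note g1 = generically_closed_loop_rank[OF this]
  obtain d2 K2 where "card V2 \<le> rank (matrix_pow (closed_loop (?A \<theta>) (S \<inter> T) d2 K2) ?N)"
    using closed_loop_of_full_rank[OF full(2)] .
  note g2 = generically_closed_loop_rank[OF this]
  obtain d K where dK: "card V1 \<le> rank (matrix_pow (closed_loop (?A \<theta>) (S \<union> T) d K) ?N)"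
      "card V2 \<le> rank (matrix_pow (closed_loop (?A \<theta>) (S \<inter> T) d K) ?N)"
    using generically_ex[OF generically_conj[OF g1 g2]] by auto
  \<comment> \<open>A single scaling \<open>d\<close> is needed here: submodularity of \<open>w\<close> holds for a fixed matrix \<open>D A\<close>.\<close>
  define w where "w S = dim (reach_space ((*v) (scale_rows d (?A \<theta>))) (coord_subspace S) ?N)" for S
  have "c1 QA TA (S \<union> T) + c1 QA TA (S \<inter> T) \<le> w (S \<union> T) + w (S \<inter> T)"
    unfolding V1(1) V2(1) w_def using dK rank_closed_loop_pow_le le_trans add_mono by meson
  also have "\<dots> \<le> w S + w T"
    unfolding w_def coord_subspace_Un
    by (rule dim_reach_space_submodular[OF matrix_vector_mul_linear subspace_coord_subspace
          subspace_coord_subspace]) (auto simp: coord_subspace_def)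
  also have "\<dots> \<le> c1 QA TA S + c1 QA TA T"
    unfolding w_def by (intro add_mono dim_reach_space_le_c1)
  finally show "c1 QA TA (S \<union> T) + c1 QA TA (S \<inter> T) \<le> c1 QA TA S + c1 QA TA T" .
qed

theorem theorem3p14:
  fixes QF QA :: "real^'n^'n" and TF TA :: "('n \<times> 'n) set"
  assumes "structurally_solvable QF TF QA TA"
  shows "submodular (c1 QA TA) \<and>
    (\<forall>m. admissible_matching QF TF QA TA m \<longrightarrow> submodular (c2 QF TF QA TA m))"
  using submodular_c1 submodular_c2 by blast

end
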